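(* Let $A\in IMS2(n,m)$. There exists a data structure of ${\rm O}(nm)$ bits that, given an index $r$ and a value $h$, computes $\min\{x\mid A[r][x]\ge h\}$ in constant time.
   Context: $IMS2(n,m)$ is the set of two-dimensional integer arrays $A[0..n-1][0..n-1]$ satisfying three conditions: - $A[i][j]\le A[i][j+1]$ for $0\le i<n$ and $0\le j<n-1$; - $A[i][j]\le A[i+1][j]$ for $0\le i<n-1$ and $0\le j<n$; - $0\le A[i][j]<m$ for all $i,j$. Space is measured in bits, in the word-RAM model. *)

theory Defs
  imports Complex_Main "HOL-Library.Log_Nat"
begin

unbundle bit_operations_syntax

text \<open>An array \<open>A[0..n-1][0..n-1]\<close> is a function of which only the values at indices below
  \<open>n\<close> matter.\<close>

definition IMS2 :: "nat \<Rightarrow> nat \<Rightarrow> (nat \<Rightarrow> nat \<Rightarrow> int) set" where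
  "IMS2 n m = {A.
     (\<forall>i j. i < n \<and> j + 1 < n \<longrightarrow> A i j \<le> A i (j + 1)) \<and>
     (\<forall>i j. i + 1 < n \<and> j < n \<longrightarrow> A i j \<le> A (i + 1) j) \<and>
     (\<forall>i j. i < n \<and> j < n \<longrightarrow> 0 \<le> A i j \<and> A i j < int m)}"

text \<open>The minimum over the empty set is taken to be \<open>n\<close>, the first index past the row.\<close>

definition first_ge :: "nat \<Rightarrow> (nat \<Rightarrow> nat \<Rightarrow> int) \<Rightarrow> nat \<Rightarrow> int \<Rightarrow> nat" where
  "first_ge n A r h =
     (if \<exists>x<n. A r x \<ge> h then Min {x. x < n \<and> A r x \<ge> h} else n)"

text \<open>A word RAM with word length \<open>w\<close>. Words are the naturals below \<open>2 ^ w\<close>; the length is a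
  parameter rather than a type because one program has to serve all word lengths. The program
  is a list of instructions over registers and a word-addressed memory. Every instruction takes
  one time step.\<close>

datatype binop = Add | Sub | Mul | Div | Mod | And | Or | Xor | Shl | Shr

fun binop_val :: "nat \<Rightarrow> binop \<Rightarrow> nat \<Rightarrow> nat \<Rightarrow> nat" where
  "binop_val w Add x y = (x + y) mod 2 ^ w"
| "binop_val w Sub x y = nat ((int x - int y) mod 2 ^ w)"
| "binop_val w Mul x y = (x * y) mod 2 ^ w"
| "binop_val w Div x y = x div y"
| "binop_val w Mod x y = x mod y"
| "binop_val w And x y = x AND y"
| "binop_val w Or x y = x OR y"
| "binop_val w Xor x y = x XOR y"
| "binop_val w Shl x y = push_bit y x mod 2 ^ w"
| "binop_val w Shr x y = drop_bit y x"

text \<open>Destination operands come first. The last operand of \<open>Const\<close> is a literal, that of a jump an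
  instruction number; all other operands are register numbers. In \<open>Load d a\<close> and \<open>Store a s\<close> the
  register \<open>a\<close> holds the memory address.\<close>

datatype instr =
    Const nat nat
  | Move nat nat
  | Binop binop nat nat nat
  | Load nat nat
  | Store nat nat
  | Jump nat
  | Jump_eq nat nat nat
  | Jump_less nat nat nat
  | Halt

record state =
  pc :: nat
  regs :: "nat \<Rightarrow> nat"
  mem :: "nat \<Rightarrow> nat"

definition set_reg :: "nat \<Rightarrow> nat \<Rightarrow> state \<Rightarrow> state" where
  "set_reg d v s = s\<lparr>pc := pc s + 1, regs := (regs s)(d := v)\<rparr>"

fun exec_instr :: "nat \<Rightarrow> instr \<Rightarrow> state \<Rightarrow> state" where
  "exec_instr w (Const d k) s = set_reg d (k mod 2 ^ w) s"
| "exec_instr w (Move d x) s = set_reg d (regs s x) s"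
| "exec_instr w (Binop f d x y) s = set_reg d (binop_val w f (regs s x) (regs s y)) s"
| "exec_instr w (Load d a) s = set_reg d (mem s (regs s a)) s"
| "exec_instr w (Store a x) s = s\<lparr>pc := pc s + 1, mem := (mem s)(regs s a := regs s x)\<rparr>"
| "exec_instr w (Jump l) s = s\<lparr>pc := l\<rparr>"
| "exec_instr w (Jump_eq x y l) s =
     s\<lparr>pc := if regs s x = regs s y then l else pc s + 1\<rparr>"
| "exec_instr w (Jump_less x y l) s =
     s\<lparr>pc := if regs s x < regs s y then l else pc s + 1\<rparr>"
| "exec_instr w Halt s = s"

definition halted :: "instr list \<Rightarrow> state \<Rightarrow> bool" where
  "halted P s \<longleftrightarrow> pc s \<ge> length P \<or> P ! pc s = Halt"

definition step :: "nat \<Rightarrow> instr list \<Rightarrow> state \<Rightarrow> state" where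
  "step w P s = (if halted P s then s else exec_instr w (P ! pc s) s)"

text \<open>The data structure \<open>D\<close> occupies the memory cells from address \<open>0\<close> on, the arguments are
  in the first registers, and everything else is \<open>0\<close>. So whatever the program needs to
  know besides the arguments has to be stored in \<open>D\<close>.\<close>

definition init_state :: "nat list \<Rightarrow> nat list \<Rightarrow> state" where
  "init_state D xs =
     \<lparr>pc = 0,
      regs = (\<lambda>i. if i < length xs then xs ! i else 0),
      mem = (\<lambda>i. if i < length D then D ! i else 0)\<rparr>"

text \<open>A query leaves the memory as it was, so that \<open>D\<close> can be queried any number of times.\<close>

definition computes_within ::
    "nat \<Rightarrow> instr list \<Rightarrow> nat \<Rightarrow> nat list \<Rightarrow> nat list \<Rightarrow> nat \<Rightarrow> bool" where
  "computes_within w P T D xs y \<longleftrightarrow>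
     (\<exists>t\<le>T. let s = (step w P ^^ t) (init_state D xs) in
        halted P s \<and> regs s 0 = y \<and> mem s = mem (init_state D xs))"

definition is_words :: "nat \<Rightarrow> nat list \<Rightarrow> bool" where
  "is_words w D \<longleftrightarrow> (\<forall>x\<in>set D. x < 2 ^ w)"

definition bit_size :: "nat \<Rightarrow> nat list \<Rightarrow> nat" where
  "bit_size w D = length D * w"

text \<open>The word length is \<open>\<Theta>(log N)\<close>: a word can hold any number up to \<open>O(N)\<close>, in particular
  any address into a memory of \<open>O(N)\<close> cells, and it has at most \<open>c\<close> times as many bits as the
  binary representation of \<open>N\<close>.\<close>

definition word_length_for :: "nat \<Rightarrow> nat \<Rightarrow> nat \<Rightarrow> nat \<Rightarrow> bool" where
  "word_length_for K c N w \<longleftrightarrow> K * N < 2 ^ w \<and> w \<le> c * floorlog 2 N"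

end

theory Submission
  imports Defs
begin

text \<open>For a fixed value \<open>h < m\<close> the answer decreases with the row \<open>r\<close>, so
  \<open>F (h * n + r) = h * n + (n - answer)\<close> is a monotone sequence of \<open>N = n * m\<close> numbers up to \<open>N\<close>,
  and it suffices to give random access to \<open>F\<close> within \<open>O(N)\<close> bits. Choose a block length \<open>W\<close>
  of about an eighth of the binary length of \<open>N\<close>, hence proportional to the word length. Cut the
  indices into pieces on which \<open>i div W\<close> and \<open>F i div W\<close> are constant; there are \<open>O(N / W)\<close> of
  them, so a constant number of words may be spent on each. Within a block of indices the number of
  the piece is a monotone function of \<open>i mod W\<close>, and within a piece so is \<open>F i\<close>; after subtracting
  a base value both are bounded by \<open>W\<close> and hence a code of \<open>2 * W\<close> bits. One table of
  \<open>4 ^ W * W\<close> words decodes all such codes.\<close>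

section \<open>Encoding monotone functions in unary\<close>

text \<open>Read from the lowest bit on, a code has a \<open>0\<close> for every increase by one of the function
  and a \<open>1\<close> for every argument.\<close>

fun unary_dec :: "nat \<Rightarrow> nat \<Rightarrow> nat" where
  "unary_dec X t =
     (if X = 0 then 0
      else if odd X then (if t = 0 then 0 else unary_dec (X div 2) (t - 1))
      else Suc (unary_dec (X div 2) t))"

declare unary_dec.simps [simp del]

text \<open>Every zero that is counted halves a nonzero number. The bound makes the decoded values
  in the table fit into words.\<close>

lemma unary_dec_le: "unary_dec X t \<le> X"
proof (induction X t rule: unary_dec.induct)
  case (1 X t)
  show ?case
  proof (cases "X = 0 \<or> odd X \<and> t = 0")
    case True
    then show ?thesis by (subst unary_dec.simps) auto
  next
    case False
    then have "X \<noteq> 0" by auto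
    show ?thesis
    proof (cases "odd X")
      case True
      then have "unary_dec (X div 2) (t - 1) \<le> X div 2" using False 1 by auto
      then show ?thesis using True False by (subst unary_dec.simps) auto
    next
      case even: False
      then have "unary_dec (X div 2) t \<le> X div 2" using False 1 by auto
      moreover have "Suc (X div 2) \<le> X" using even \<open>X \<noteq> 0\<close> by presburger
      ultimately show ?thesis using even \<open>X \<noteq> 0\<close> by (subst unary_dec.simps) auto
    qed
  qed
qed

lemma unary_dec_double: "X > 0 \<Longrightarrow> unary_dec (2 * X) t = Suc (unary_dec X t)"
  by (subst unary_dec.simps) simp

lemma unary_dec_double_Suc_0: "unary_dec (Suc (2 * X)) 0 = 0"
  by (subst unary_dec.simps) simp

lemma unary_dec_double_Suc_Suc: "unary_dec (Suc (2 * X)) (Suc t) = unary_dec X t"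
  by (subst unary_dec.simps) simp

text \<open>The code is built from its lowest bit: if \<open>f 0 = 0\<close>, write a
  \<open>1\<close> and drop the first argument, otherwise write a \<open>0\<close> and lower all
  values by one. This takes \<open>k\<close> ones and at most \<open>s\<close> zeros. Positivity is
  carried along because the decoder takes \<open>0\<close> for the end of the code, so zeros may
  only be put below a nonzero rest.\<close>

lemma unary_code_exists:
  assumes "mono f" and "\<And>t. f t \<le> s"
  shows "\<exists>X. X < 2 ^ (k + s) \<and> (k > 0 \<longrightarrow> X > 0) \<and> (\<forall>t<k. unary_dec X t = f t)"
  using assms
proof (induction "k + s" arbitrary: k s f)
  case 0
  then show ?case by auto
next
  case (Suc l)
  show ?case
  proof (cases k)
    case 0
    then show ?thesis by (auto intro!: exI[of _ 0])
  next
    case k: (Suc k')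
    show ?thesis
    proof (cases "f 0 = 0")
      case True
      have "mono (\<lambda>t. f (Suc t))" using Suc.prems(1) by (auto simp: mono_def)
      then obtain X where X: "X < 2 ^ (k' + s)" "\<forall>t<k'. unary_dec X t = f (Suc t)"
        using Suc.hyps(1)[of k' s "\<lambda>t. f (Suc t)"] Suc.hyps(2) Suc.prems k by auto
      have "unary_dec (Suc (2 * X)) t = f t" if "t < k" for t
        using that X(2) True k by (cases t) (auto simp: unary_dec_double_Suc_0 unary_dec_double_Suc_Suc)
      moreover have "Suc (2 * X) < 2 ^ (k + s)" using X(1) k by simp
      ultimately show ?thesis by blast
    next
      case False
      then obtain s' where s: "s = Suc s'" using Suc.prems(2)[of 0] by (cases s) auto
      have pos: "f t > 0" for t using False Suc.prems(1) by (metis bot_nat_0.not_eq_extremum le0 less_le_trans monoD)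
      have "mono (\<lambda>t. f t - 1)" using Suc.prems(1) by (auto simp: mono_def diff_le_mono)
      moreover have "f t - 1 \<le> s'" for t using Suc.prems(2)[of t] s by simp
      ultimately obtain X where X: "X < 2 ^ (k + s')" "X > 0" "\<forall>t<k. unary_dec X t = f t - 1"
        using Suc.hyps(1)[of k s' "\<lambda>t. f t - 1"] Suc.hyps(2) s k by auto
      have "unary_dec (2 * X) t = f t" if "t < k" for t
        using that X pos[of t] by (simp add: unary_dec_double)
      moreover have "2 * X < 2 ^ (k + s)" using X(1) s by simp
      ultimately show ?thesis using X(2) by (metis nat_0_less_mult_iff zero_less_numeral)
    qed
  qed
qed

section \<open>Random access to a monotone sequence\<close>

fun piece :: "nat \<Rightarrow> (nat \<Rightarrow> nat) \<Rightarrow> nat \<Rightarrow> nat" where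
  "piece W F 0 = 0"
| "piece W F (Suc i) = piece W F i +
     (if Suc i div W = i div W \<and> F (Suc i) div W = F i div W then 0 else 1)"

lemma mono_piece: "mono (piece W F)"
  by (rule incseq_SucI) simp

lemma piece_add_le: "piece W F (i + d) \<le> piece W F i + d"
  by (induction d) auto

text \<open>Each new piece raises \<open>i div W\<close> or \<open>F i div W\<close> by at least
  one. With \<open>i\<close> and \<open>F i\<close> at most \<open>N\<close> this gives the
  \<open>O(N / W)\<close> bound on the number of pieces.\<close>

lemma piece_le:
  assumes "mono F"
  shows "piece W F i \<le> i div W + F i div W"
proof (induction i)
  case (Suc i)
  have "i div W \<le> Suc i div W" "F i div W \<le> F (Suc i) div W"
    using assms by (auto intro!: div_le_mono simp: mono_def)
  moreover have "p + (if a' = a \<and> b' = b then 0 else 1) \<le> a' + b'"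
    if "a \<le> a'" "b \<le> b'" "p \<le> a + b" for p a a' b b' :: nat
    using that by auto
  ultimately show ?case using Suc unfolding piece.simps by blast
qed simp

text \<open>The counter is monotone, so equal values at both ends exclude any change in
  between.\<close>

lemma piece_eq:
  assumes "piece W F i = piece W F j"
  shows "i div W = j div W \<and> F i div W = F j div W"
proof -
  have "i \<le> j \<Longrightarrow> piece W F i = piece W F j \<Longrightarrow>
      i div W = j div W \<and> F i div W = F j div W" for i j
  proof (induction j rule: dec_induct)
    case (step j)
    have "piece W F i \<le> piece W F j" using mono_piece step.hyps(1) by (rule monoD)
    then show ?case using step by (auto split: if_splits)
  qed simp
  then show ?thesis using assms by (metis nat_le_linear)
qed

text \<open>A lookup in two levels: \<open>R\<close> and \<open>M\<close> of the block give the
  number of the piece, \<open>B\<close> and \<open>X\<close> of the piece give \<open>F i\<close>.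
  Both codes take the argument \<open>i mod W\<close>, as a piece lies within one block.\<close>

lemma piece_tables_exist:
  assumes "mono F" "W > 0"
  shows "\<exists>R M B X.
     (\<forall>q. R q \<le> piece W F (q * W)) \<and> (\<forall>q. M q < 4 ^ W) \<and> (\<forall>k. X k < 4 ^ W) \<and>
     (\<forall>i. piece W F i = R (i div W) + unary_dec (M (i div W)) (i mod W)) \<and>
     (\<forall>k. \<exists>i. B k \<le> F i) \<and>
     (\<forall>i. F i = B (piece W F i) + unary_dec (X (piece W F i)) (i mod W))"
proof -
  \<comment> \<open>Clamping at \<open>W\<close> bounds the function at all arguments, so that
    \<open>W\<close> ones and at most \<open>W\<close> zeros suffice. At the arguments that get
    decoded the difference is below \<open>W\<close> and the clamp has no effect.\<close>
  have code: "\<exists>Y. Y < 4 ^ W \<and> (\<forall>t<W. unary_dec Y t = min W (f (a + t) - b))"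
    if "mono f" for f :: "nat \<Rightarrow> nat" and a b
  proof -
    have "mono (\<lambda>t. min W (f (a + t) - b))"
      using that by (intro monoI min.mono diff_le_mono) (auto simp: mono_def)
    then show ?thesis
      using unary_code_exists[of "\<lambda>t. min W (f (a + t) - b)" W W]
      by (auto simp: power_add power_mult_distrib[symmetric])
  qed
  define enc where "enc f a b = (SOME Y. Y < 4 ^ W \<and> (\<forall>t<W. unary_dec Y t = min W (f (a + t) - b)))"
    for f a b
  have enc: "enc f a b < 4 ^ W \<and> (\<forall>t<W. unary_dec (enc f a b) t = min W (f (a + t) - b))"
    if "mono f" for f a b
    unfolding enc_def by (rule someI_ex[OF code[OF that]])
  have mod_split: "i div W * W + i mod W = i" "i mod W < W" for i
    using assms(2) by auto
  define M where "M q = enc (piece W F) (q * W) (piece W F (q * W))" for q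
  have M: "M q < 4 ^ W"
    "t < W \<Longrightarrow> unary_dec (M q) t = min W (piece W F (q * W + t) - piece W F (q * W))" for q t
    using enc[OF mono_piece] by (auto simp: M_def)
  have M_eq: "piece W F i = piece W F (i div W * W) + unary_dec (M (i div W)) (i mod W)" for i
  proof -
    have "piece W F (i div W * W) \<le> piece W F i"
      by (rule monoD[OF mono_piece]) (rule div_times_less_eq_dividend)
    moreover have "piece W F i \<le> piece W F (i div W * W) + i mod W"
      using piece_add_le[of W F "i div W * W" "i mod W"] by (simp add: mod_split)
    ultimately show ?thesis using M(2)[of "i mod W" "i div W"] mod_split(2)[of i]
      by (simp add: mod_split)
  qed
  \<comment> \<open>If no index has the number \<open>k\<close>, \<open>rep k\<close> is
    unspecified, but \<open>B k\<close> is still at most some value of \<open>F\<close>. Hence every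
    cell of the layout can be filled with a bounded number.\<close>
  define rep where "rep k = (SOME i. piece W F i = k)" for k
  define B where "B k = F (rep k) div W * W" for k
  have rep: "piece W F (rep (piece W F i)) = piece W F i" for i
    unfolding rep_def by (rule someI) (rule refl)
  \<comment> \<open>The code covers the whole block of indices, not only the piece: before the piece
    the truncated difference is \<open>0\<close>, after it the clamp gives \<open>W\<close>.\<close>
  define X where "X k = enc F (rep k div W * W) (B k)" for k
  have X: "X k < 4 ^ W"
    "t < W \<Longrightarrow> unary_dec (X k) t = min W (F (rep k div W * W + t) - B k)" for k t
    using enc[OF assms(1)] by (auto simp: X_def)
  have B: "B (piece W F i) = F i div W * W" for i
    using piece_eq[OF rep, of i] by (simp add: B_def)
  have F_eq: "F i = B (piece W F i) + unary_dec (X (piece W F i)) (i mod W)" for i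
  proof -
    have "unary_dec (X (piece W F i)) (i mod W) = min W (F i - B (piece W F i))"
      using X(2)[OF mod_split(2)] piece_eq[OF rep, of i] by (simp add: mod_split)
    also have "\<dots> = F i mod W" using mod_split(2)[of "F i"] unfolding B
      by (simp add: minus_div_mult_eq_mod)
    finally show ?thesis by (simp add: B)
  qed
  have B_le: "\<exists>i. B k \<le> F i" for k
    unfolding B_def by (rule exI[of _ "rep k"]) (rule div_times_less_eq_dividend)
  show ?thesis
    by (rule exI[of _ "\<lambda>q. piece W F (q * W)"], rule exI[of _ M], rule exI[of _ B],
        rule exI[of _ X], intro conjI allI)
      (rule order_refl M(1) X(1) M_eq B_le F_eq)+
qed

section \<open>The query program\<close>

text \<open>The memory holds \<open>n\<close>, \<open>m\<close>, \<open>W\<close>, then a pair of words for each block of indices, a pair for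
  each piece, and the decoding table. A pair consists of the base value (for blocks: the
  address of the pair of the first piece) and the address in the table of the row of its code.
  Register 10 is never written and serves as the constant \<open>0\<close>.\<close>

definition query :: "instr list" where
  "query =
    [Const 2 1, Const 3 2, Load 4 10, Load 5 2, Jump_less 1 5 7, Move 0 4, Halt,
     Load 6 3, Binop Mul 7 1 4, Binop Add 8 7 0, Binop Div 9 8 6, Binop Mod 8 8 6,
     Binop Add 9 9 9, Binop Add 9 9 3, Binop Add 9 9 2, Load 5 9,
     Binop Add 9 9 2, Load 9 9, Binop Add 9 9 8, Load 9 9,
     Binop Add 9 9 9, Binop Add 5 5 9, Load 9 5,
     Binop Add 5 5 2, Load 5 5, Binop Add 5 5 8, Load 5 5,
     Binop Add 9 9 5, Binop Add 7 7 4, Binop Sub 0 7 9]"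

lemma step_nth:
  "k < length P \<Longrightarrow> step w P \<lparr>pc = k, regs = R, mem = M\<rparr> = exec_instr w (P ! k) \<lparr>pc = k, regs = R, mem = M\<rparr>"
  by (simp add: step_def halted_def)

lemma length_query: "length query = 30"
  by (simp add: query_def)

text \<open>Queries range over all words \<open>h\<close>, but the sequence only covers
  \<open>h < m\<close>. For other \<open>h\<close> the jump is not taken, and the program halts
  after six steps with \<open>n\<close> from cell \<open>0\<close>.\<close>

lemma query_large:
  assumes "w > 1" "length D > 1" "D ! 0 = n" "D ! 1 \<le> h"
  shows "computes_within w query 30 D [r, h] n"
proof -
  define mm where "mm = (\<lambda>i. if i < length D then D ! i else 0)"
  have mm: "mm 0 = n" "\<not> h < mm 1" using assms by (auto simp: mm_def)
  have one: "1 mod 2 ^ w = (1::nat)" using assms(1) by simp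
  have six: "(f ^^ 6) x = f (f (f (f (f (f x)))))" for f :: "state \<Rightarrow> state" and x
    by (simp add: eval_nat_numeral)
  show ?thesis unfolding computes_within_def Let_def
    by (rule exI[of _ 6])
      (simp add: six step_def halted_def query_def set_reg_def
        init_state_def mm_def[symmetric] mm mm[unfolded One_nat_def] one one[unfolded One_nat_def] assms(1)[THEN gr_implies_not0]
        del: One_nat_def)
qed

text \<open>Symbolic execution of the main branch: cells \<open>2 * q + 3\<close> and
  \<open>2 * q + 4\<close> are the pair of the block, \<open>k\<close> is the number of the piece
  relative to the first piece of the block, and \<open>B + d\<close> is the value of the sequence at
  \<open>i\<close>.\<close>

lemma query_small:
  assumes D: "D ! 0 = n" "D ! 1 = m" "D ! 2 = W" and len: "length D \<le> 2 ^ w"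
    and h: "h < m" and i: "i = h * n + r" "q = i div W" "t = i mod W"
    and rank: "2 * q + 4 < length D" "R = D ! (2 * q + 3)" "M = D ! (2 * q + 4)"
      "M + t < length D" "k = D ! (M + t)" "R + 2 * k + 1 < length D"
    and val: "B = D ! (R + 2 * k)" "X = D ! (R + 2 * k + 1)"
      "X + t < length D" "d = D ! (X + t)"
    and bound: "r < n" "B + d \<le> h * n + n" "h * n + n < 2 ^ w"
  shows "computes_within w query 30 D [r, h] (h * n + n - (B + d))"
proof -
  define mm where "mm = (\<lambda>i. if i < length D then D ! i else 0)"
  \<comment> \<open>Each intermediate register value gets a name, so that the simplifier runs the
    program by rewriting names and never meets \<open>mod 2 ^ w\<close>.\<close>
  define q2 q3 q4 q5 where "q2 = 2 * q" "q3 = q2 + 2" "q4 = q3 + 1" "q5 = q4 + 1"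
  define Mt k2 Rk Rk1 Xt hn hnn f
    where "Mt = M + t" "k2 = 2 * k" "Rk = R + k2" "Rk1 = Rk + 1" "Xt = X + t"
      "hn = h * n" "hnn = hn + n" "f = B + d"
  note defs = q2_q3_q4_q5_def Mt_k2_Rk_Rk1_Xt_hn_hnn_f_def
  have eqs: "2 * q + 3 = q4" "2 * q + 4 = q5" "R + 2 * k = Rk" "R + 2 * k + 1 = Rk1"
    "h * n + n = hnn" by (auto simp: defs)
  have "q5 < 2 ^ w" using len rank(1) by (simp add: eqs)
  then have w: "2 < (2::nat) ^ w" by (simp add: defs)
  then have "w \<noteq> 0" by (cases w) simp_all
  have small: "2 < length D" using rank(1) by linarith
  have mem: "mm 0 = n" "mm 1 = m" "mm 2 = W" "mm q4 = R" "mm q5 = M" "mm Mt = k"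
    "mm Rk = B" "mm Rk1 = X" "mm Xt = d"
    using D rank val small unfolding mm_def eqs by (auto simp: defs)
  have arith: "binop_val w Mul h n = hn" "binop_val w Add hn r = i" "binop_val w Div i W = q"
    "binop_val w Mod i W = t" "binop_val w Add q q = q2" "binop_val w Add q2 2 = q3"
    "binop_val w Add q3 1 = q4" "binop_val w Add q4 1 = q5" "binop_val w Add M t = Mt"
    "binop_val w Add k k = k2" "binop_val w Add R k2 = Rk" "binop_val w Add Rk 1 = Rk1"
    "binop_val w Add X t = Xt" "binop_val w Add B d = f" "binop_val w Add hn n = hnn"
    using len i rank val bound by (auto simp: defs)
  have sub: "binop_val w Sub hnn f = hnn - f"
  proof -
    have "int hnn - int f = int (hnn - f)" "hnn - f < 2 ^ w" using bound by (auto simp: defs)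
    then show ?thesis by (simp del: of_nat_diff flip: of_nat_power zmod_int)
  qed
  have const: "1 mod 2 ^ w = (1::nat)" "2 mod 2 ^ w = (2::nat)"
    using w \<open>w \<noteq> 0\<close> by simp_all
  have run: "(g ^^ 28) x = g (g (g (g (g (g (g (g (g (g (g (g (g (g (g (g (g (g (g (g (g (g
      (g (g (g (g (g (g x)))))))))))))))))))))))))))" for g :: "state \<Rightarrow> state" and x
    by (simp add: eval_nat_numeral)
  show ?thesis unfolding computes_within_def Let_def eqs defs(12)[symmetric]
    \<comment> \<open>Five instructions up to the jump and the 23 from number 7 on; the program
      halts by running off its end.\<close>
    by (rule exI[of _ 28], rule conjI, simp, simp only: run init_state_def mm_def[symmetric])
      (simp add: step_nth length_query query_def[THEN arg_cong[of _ _ "\<lambda>P. P ! k" for k]]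
        set_reg_def halted_def h arith sub arith[unfolded One_nat_def]
        mem mem[unfolded One_nat_def] const const[unfolded One_nat_def] \<open>w \<noteq> 0\<close>
        del: One_nat_def binop_val.simps)
qed

section \<open>Memory layout\<close>

text \<open>All cells are word-sized later because each holds an address in \<open>D\<close>, a
  value up to \<open>N\<close>, the number \<open>W\<close>, or a decoded value below
  \<open>4 ^ W\<close>.\<close>

lemma memory_exists:
  assumes "mono F" "\<And>i. F i \<le> N" "W > 0" "n \<le> N" "m \<le> N"
  shows "\<exists>D. length D = 7 + 6 * (N div W) + 4 ^ W * W \<and>
    (\<forall>x\<in>set D. x \<le> length D + N) \<and> D ! 0 = n \<and> D ! 1 = m \<and> D ! 2 = W \<and>
    (\<forall>i\<le>N. let q = i div W; t = i mod W in
      \<exists>R M k B X d. 2 * q + 4 < length D \<and> R = D ! (2 * q + 3) \<and> M = D ! (2 * q + 4) \<and>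
        M + t < length D \<and> k = D ! (M + t) \<and> R + 2 * k + 1 < length D \<and>
        B = D ! (R + 2 * k) \<and> X = D ! (R + 2 * k + 1) \<and> X + t < length D \<and>
        d = D ! (X + t) \<and> F i = B + d)"
proof -
  obtain R M B X where
    R: "\<And>q. R q \<le> piece W F (q * W)" and M: "\<And>q. M q < 4 ^ W" and X: "\<And>k. X k < 4 ^ W"
    and piece: "\<And>i. piece W F i = R (i div W) + unary_dec (M (i div W)) (i mod W)"
    and B: "\<And>k. \<exists>i. B k \<le> F i"
    and F: "\<And>i. F i = B (piece W F i) + unary_dec (X (piece W F i)) (i mod W)"
    using piece_tables_exist[OF assms(1,3)] by metis
  \<comment> \<open>After three header cells come \<open>Q + 1\<close> pairs for the blocks, from
    \<open>a\<close> on \<open>2 * Q + 1\<close> pairs for the pieces, and from \<open>b\<close> on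
    the table with rows of \<open>W\<close> cells.\<close>
  define Q a b len where "Q = N div W" "a = 5 + 2 * Q" "b = 7 + 6 * Q" "len = b + 4 ^ W * W"
  note defs = Q_a_b_len_def
  define cell where "cell p =
    (if p = 0 then n else if p = 1 then m else if p = 2 then W
     else if p < a then
       (if odd p then a + 2 * R ((p - 3) div 2) else b + M ((p - 3) div 2) * W)
     else if p < b then
       (if even (p - a) then B ((p - a) div 2) else b + X ((p - a) div 2) * W)
     else unary_dec ((p - b) div W) ((p - b) mod W))" for p
  define D where "D = map cell [0..<len]"
  have D: "length D = len" "p < len \<Longrightarrow> D ! p = cell p" for p by (simp_all add: D_def)
  have slot: "Y * W + t < 4 ^ W * W" if "Y < 4 ^ W" "t < W" for Y t
  proof -
    have "Suc Y * W \<le> 4 ^ W * W" using that(1) by (intro mult_le_mono1) simp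
    with that(2) show ?thesis by simp
  qed
  have slot0: "b + Y * W < len" if "Y < 4 ^ W" for Y
    using slot[OF that assms(3)] by (simp add: defs)
  have piece_Q: "piece W F i \<le> 2 * Q" if "i \<le> N" for i
  proof -
    have "i div W \<le> Q" "F i div W \<le> Q" using that assms(2) by (auto simp: defs div_le_mono)
    then show ?thesis using piece_le[OF assms(1), of W i] by linarith
  qed
  have R_Q: "R q \<le> 2 * Q" if "q \<le> Q" for q
  proof -
    have "q * W \<le> N" using that by (metis assms(3) defs(1) less_eq_div_iff_mult_less_eq)
    then show ?thesis using R[of q] piece_Q[of "q * W"] by linarith
  qed
  have B_N: "B k \<le> N" for k using B[of k] assms(2) le_trans by blast
  have W_le: "W \<le> 4 ^ W" by (rule less_imp_le) (rule less_exp[THEN less_le_trans], rule power_mono, auto)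
  have "4 ^ W * 1 \<le> 4 ^ W * W" using assms(3) by (intro mult_le_mono2) simp
  then have pow_len: "4 ^ W \<le> len" unfolding defs by linarith
  with W_le have W_len: "W \<le> len" by linarith
  have cell_le: "cell p \<le> len + N" if "p < len" for p
  proof -
    consider "p \<le> 2" | "2 < p" "p < a" | "a \<le> p" "p < b" | "b \<le> p" by linarith
    then show ?thesis
    proof cases
      case 1
      then show ?thesis using assms(4,5) W_len by (simp add: cell_def)
    next
      case 2
      then have "(p - 3) div 2 \<le> Q" by (auto simp: defs)
      then have "a + 2 * R ((p - 3) div 2) \<le> len" using R_Q[of "(p - 3) div 2"] by (simp add: defs)
      then show ?thesis using 2 slot0[OF M, of "(p - 3) div 2"] by (auto simp: cell_def)
    next
      case 3
      then have "\<not> p < a" "p > 2" by (auto simp: defs)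
      then show ?thesis using 3 slot0[OF X, of "(p - a) div 2"] B_N[of "(p - a) div 2"]
        by (auto simp: cell_def)
    next
      case 4
      then have "\<not> p < a" "\<not> p < b" "p > 2" by (auto simp: defs)
      moreover have "(p - b) div W < 4 ^ W" using that 4 assms(3)
        by (simp add: defs less_mult_imp_div_less)
      ultimately show ?thesis using unary_dec_le[of "(p - b) div W" "(p - b) mod W"] pow_len
        by (auto simp: cell_def)
    qed
  qed
  have table: "b + Y * W + t < len" "cell (b + Y * W + t) = unary_dec Y t"
    if "Y < 4 ^ W" "t < W" for Y t
    using slot[OF that] that(2) by (auto simp: cell_def defs)
  have head: "cell (2 * q + 3) = a + 2 * R q" "cell (2 * q + 4) = b + M q * W" if "q \<le> Q" for q
    using that by (auto simp: cell_def defs)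
  have body: "cell (a + 2 * k) = B k" "cell (a + 2 * k + 1) = b + X k * W" if "k \<le> 2 * Q" for k
    using that by (auto simp: cell_def defs)
  have "\<exists>R' M' k B' X' d. 2 * q + 4 < len \<and> R' = D ! (2 * q + 3) \<and> M' = D ! (2 * q + 4) \<and>
      M' + t < len \<and> k = D ! (M' + t) \<and> R' + 2 * k + 1 < len \<and>
      B' = D ! (R' + 2 * k) \<and> X' = D ! (R' + 2 * k + 1) \<and> X' + t < len \<and>
      d = D ! (X' + t) \<and> F i = B' + d"
    if i: "i \<le> N" and q: "q = i div W" and t: "t = i mod W" for i q t
  proof -
    define k where "k = unary_dec (M q) t"
    define j where "j = piece W F i"
    have tW: "t < W" using t assms(3) by simp
    have qQ: "q \<le> Q" using i q by (simp add: defs div_le_mono)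
    have j: "j = R q + k" "j \<le> 2 * Q" using piece piece_Q[OF i] by (auto simp: j_def k_def q t)
    have len: "2 * q + 4 < len" "a + 2 * j + 1 < len" using qQ j(2) by (auto simp: defs)
    have ad: "a + 2 * R q + 2 * k = a + 2 * j" by (simp add: j)
    have DR: "D ! (2 * q + 3) = a + 2 * R q" using D(2) len(1) head(1)[OF qQ] by simp
    have DM: "D ! (2 * q + 4) = b + M q * W" using D(2) len(1) head(2)[OF qQ] by simp
    have Dk: "D ! (b + M q * W + t) = k" using D(2) table[OF M tW] by (simp add: k_def)
    have DB: "D ! (a + 2 * j) = B j" using D(2) len(2) body(1)[OF j(2)] by simp
    have DX: "D ! (a + 2 * j + 1) = b + X j * W" using D(2)[OF len(2)] body(2)[OF j(2)] by simp
    have Dd: "D ! (b + X j * W + t) = unary_dec (X j) t" using D(2) table[OF X tW] by simp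
    have "F i = B j + unary_dec (X j) t" using F[of i] by (simp add: j_def t)
    then show ?thesis using len table(1)[OF M tW, of q] table(1)[OF X tW, of j]
      unfolding simp_thms DR DM Dk ad DB DX Dd by (simp add: DR DM Dk ad DB DX Dd del: One_nat_def)
  qed
  moreover have "D ! 0 = n" "D ! 1 = m" "D ! 2 = W"
    using D(2)[of 0] D(2)[of 1] D(2)[of 2] by (simp_all add: cell_def defs)
  moreover have "\<forall>x\<in>set D. x \<le> length D + N"
    using cell_le by (auto simp: D_def)
  ultimately show ?thesis using D(1) unfolding Let_def
    by (intro exI[of _ D]) (simp add: defs)
qed

text \<open>With \<open>v = 2 ^ (l div 8)\<close> the table has at most \<open>4 * v ^ 3\<close>
  words of at most \<open>8 * c * v\<close> bits, which \<open>v ^ 8 <= 2 * N\<close> absorbs. The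
  \<open>N div W\<close> groups of cells cost \<open>O(c * W)\<close> bits each, since the
  \<open>+ 1\<close> in \<open>W\<close> ensures \<open>l <= 8 * W\<close>.\<close>

lemma block_length_bounds:
  assumes "N > 0" "W = floorlog 2 N div 8 + 1"
  shows "4 ^ W * W \<le> 8 * N" "floorlog 2 N \<le> N" "w \<le> c * floorlog 2 N \<Longrightarrow>
    (7 + 6 * (N div W) + 4 ^ W * W) * w \<le> 119 * c * N"
proof -
  define l v where "l = floorlog 2 N" "v = (2::nat) ^ (l div 8)"
  have low: "2 ^ (l - 1) \<le> N" using floorlog_bounds[of N 2] assms(1) by (simp add: l_v_def)
  have "l - 1 < 2 ^ (l - 1)" by (rule less_exp)
  with low have l: "l \<le> N" by linarith
  then show "floorlog 2 N \<le> N" by (simp add: l_v_def)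
  have v: "v \<ge> 1" by (simp add: l_v_def)
  have "v ^ 8 = 2 ^ (l div 8 * 8)" unfolding l_v_def by (simp only: power_mult)
  also have "\<dots> \<le> 2 ^ l" by (rule power_increasing) auto
  also have "\<dots> \<le> 2 * 2 ^ (l - 1)" by (cases l) auto
  finally have v8: "v ^ 8 \<le> 2 * N" using low by linarith
  have v_pow: "v ^ k \<le> 2 * N" if "k \<le> 8" for k
    using power_increasing[OF that v] v8 by linarith
  have W: "W \<le> v" unfolding assms(2) l_v_def by (simp add: Suc_leI)
  have four: "4 ^ W = 4 * v ^ 2"
    unfolding assms(2) l_v_def by (simp add: power_mult[symmetric] mult.commute[of _ 2] power_mult)
  have "4 ^ W * W \<le> 4 * v ^ 2 * v" unfolding four using W by (rule mult_le_mono2)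
  also have "\<dots> = 4 * v ^ 3" by (simp add: power2_eq_square power3_eq_cube)
  finally have table: "4 ^ W * W \<le> 4 * v ^ 3" .
  with v_pow[of 3] show "4 ^ W * W \<le> 8 * N" by linarith
  show "(7 + 6 * (N div W) + 4 ^ W * W) * w \<le> 119 * c * N" if w: "w \<le> c * floorlog 2 N"
  proof -
    have "l \<le> 8 * W" unfolding assms(2) l_v_def by presburger
    then have wW: "w \<le> 8 * c * W" using w by (metis l_v_def(1) le_trans mult.assoc mult.commute mult_le_mono2)
    have "w \<le> c * N" using w l by (metis l_v_def(1) le_trans mult_le_mono2)
    moreover have "N div W * w \<le> 8 * c * N"
    proof -
      have "N div W * w \<le> N div W * (8 * c * W)" using wW by (rule mult_le_mono2)
      also have "\<dots> = 8 * c * (N div W * W)" by simp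
      also have "\<dots> \<le> 8 * c * N" by (intro mult_le_mono2 div_times_less_eq_dividend)
      finally show ?thesis .
    qed
    moreover have "4 ^ W * W * w \<le> 64 * c * N"
    proof -
      have "w \<le> 8 * c * v" using wW W by (meson le_trans mult_le_mono2)
      with table have "4 ^ W * W * w \<le> 4 * v ^ 3 * (8 * c * v)" by (rule mult_le_mono)
      also have "\<dots> = 32 * c * v ^ 4" by (simp add: power_numeral_reduce)
      also have "\<dots> \<le> 32 * c * (2 * N)" by (intro mult_le_mono2 v_pow) simp
      finally show ?thesis by simp
    qed
    \<comment> \<open>The constant is \<open>119 = 7 + 6 * 8 + 64\<close>.\<close>
    ultimately show ?thesis unfolding add_mult_distrib by linarith
  qed
qed

section \<open>Rows of a monotone array\<close>

lemma first_ge_le: "first_ge n A r h \<le> n"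
proof (cases "\<exists>x<n. A r x \<ge> h")
  case True
  then obtain x where "x < n" "A r x \<ge> h" by blast
  then have "Min {x. x < n \<and> A r x \<ge> h} \<le> x" by (intro Min_le) auto
  with \<open>x < n\<close> True show ?thesis by (simp add: first_ge_def)
qed (auto simp: first_ge_def)

text \<open>The larger row has more candidates for the minimum. If the smaller row has none, its
  value is the default \<open>n\<close>, which bounds every answer.\<close>

lemma first_ge_antimono:
  assumes "\<And>x. x < n \<Longrightarrow> A r x \<le> A r' x"
  shows "first_ge n A r' h \<le> first_ge n A r h"
proof (cases "\<exists>x<n. A r x \<ge> h")
  case True
  then have "\<exists>x<n. A r' x \<ge> h" "{x. x < n \<and> A r x \<ge> h} \<subseteq> {x. x < n \<and> A r' x \<ge> h}"
    using assms by (fastforce intro: order_trans)+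
  moreover have "{x. x < n \<and> A r x \<ge> h} \<noteq> {}" using True by blast
  ultimately have "Min {x. x < n \<and> A r' x \<ge> h} \<le> Min {x. x < n \<and> A r x \<ge> h}"
    by (intro Min_antimono) auto
  then show ?thesis using True \<open>\<exists>x<n. A r' x \<ge> h\<close> unfolding first_ge_def by presburger
next
  case False
  then have "first_ge n A r h = n" unfolding first_ge_def by (rule if_not_P)
  then show ?thesis using first_ge_le[of n A r' h] by simp
qed

lemma IMS2_column_mono:
  assumes "A \<in> IMS2 n m" "r \<le> r'" "r' < n" "x < n"
  shows "A r x \<le> A r' x"
  using assms(2,3)
proof (induction r' rule: dec_induct)
  case (step r')
  then have "A r' x \<le> A (r' + 1) x" using assms(1,4) by (auto simp: IMS2_def)
  with step show ?case by simp
qed simp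

lemma first_ge_max:
  assumes "A \<in> IMS2 n m" "r < n" "m \<le> h"
  shows "first_ge n A r (int h) = n"
proof -
  have "A r x < int h" if "x < n" for x
  proof -
    have "A r x < int m" using assms(1,2) that by (simp add: IMS2_def)
    with assms(3) show ?thesis by linarith
  qed
  then have "\<not> (\<exists>x<n. A r x \<ge> int h)" by (meson not_le)
  then show ?thesis unfolding first_ge_def by (rule if_not_P)
qed

text \<open>The constant \<open>n * m\<close> from index \<open>n * m\<close> on makes the sequence
  monotone and bounded on all naturals.\<close>

definition row_seq :: "nat \<Rightarrow> nat \<Rightarrow> (nat \<Rightarrow> nat \<Rightarrow> int) \<Rightarrow> nat \<Rightarrow> nat" where
  "row_seq n m A i = (if i < n * m
     then i div n * n + (n - first_ge n A (i mod n) (int (i div n))) else n * m)"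

lemma row_seq_le:
  assumes "i < n * m"
  shows "row_seq n m A i \<le> i div n * n + n" "i div n * n + n \<le> n * m"
proof -
  have "i div n < m" using assms by (simp add: less_mult_imp_div_less mult.commute)
  then have "Suc (i div n) * n \<le> m * n" by (intro mult_le_mono1) simp
  then show "i div n * n + n \<le> n * m" by (simp add: mult.commute)
qed (use assms in \<open>simp add: row_seq_def\<close>)

text \<open>For equal \<open>i div n\<close> the columns are monotone, so the answers decrease. A
  larger \<open>i div n\<close> raises the offset by at least \<open>n\<close>, which outweighs the
  second summand.\<close>

lemma mono_row_seq:
  assumes "A \<in> IMS2 n m"
  shows "mono (row_seq n m A)"
proof
  fix i j :: nat
  assume "i \<le> j"
  show "row_seq n m A i \<le> row_seq n m A j"
  proof (cases "j < n * m")
    case False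
    then show ?thesis using row_seq_le(1)[of i n m A] row_seq_le(2)[of i n m] by (cases "i < n * m") (auto simp: row_seq_def)
  next
    case j: True
    with \<open>i \<le> j\<close> have i: "i < n * m" by simp
    have n: "n > 0" using i by (cases n) auto
    show ?thesis
    proof (cases "i div n = j div n")
      case True
      then have "i mod n \<le> j mod n" using \<open>i \<le> j\<close>
        by (metis add_le_cancel_left div_mult_mod_eq)
      then have "first_ge n A (j mod n) (int (j div n)) \<le> first_ge n A (i mod n) (int (j div n))"
        using n by (intro first_ge_antimono IMS2_column_mono[OF assms]) auto
      then show ?thesis using i j True by (simp add: row_seq_def)
    next
      case False
      then have "Suc (i div n) \<le> j div n" using div_le_mono[OF \<open>i \<le> j\<close>, of n] by simp
      then have "Suc (i div n) * n \<le> j div n * n" by (rule mult_le_mono1)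
      also have "\<dots> \<le> row_seq n m A j" using j by (simp add: row_seq_def)
      finally show ?thesis using row_seq_le(1)[OF i, of A] by simp
    qed
  qed
qed

theorem theorem8:
  shows "\<exists>(P :: instr list) (T :: nat) (K :: nat). \<forall>c :: nat. \<exists>C :: nat.
    \<forall>(n :: nat) (m :: nat) (w :: nat) (A :: nat \<Rightarrow> nat \<Rightarrow> int).
      A \<in> IMS2 n m \<and> word_length_for K c (n * m) w \<longrightarrow>
      (\<exists>D. is_words w D \<and> bit_size w D \<le> C * (n * m) \<and>
        (\<forall>r h :: nat. r < n \<and> h < 2 ^ w \<longrightarrow>
          computes_within w P T D [r, h] (first_ge n A r (int h))))"
proof (rule exI, rule exI, rule exI, rule allI, rule exI, intro allI impI, elim conjE)
  fix c n m w :: nat and A :: "nat \<Rightarrow> nat \<Rightarrow> int"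
  assume A: "A \<in> IMS2 n m" and wl: "word_length_for 32 c (n * m) w"
  show "\<exists>D. is_words w D \<and> bit_size w D \<le> (119 * c) * (n * m) \<and>
        (\<forall>r h :: nat. r < n \<and> h < 2 ^ w \<longrightarrow>
          computes_within w query 30 D [r, h] (first_ge n A r (int h)))"
  \<comment> \<open>Here the space bound is \<open>0\<close>, which forces the empty list, and there
    is no row to query.\<close>
  proof (cases "n = 0")
    case True
    then show ?thesis by (intro exI[of _ "[]"]) (simp add: is_words_def bit_size_def)
  next
    case False
    have "m > 0" using A False by (cases m) (force simp: IMS2_def)+
    define N W where "N = n * m" "W = floorlog 2 N div 8 + 1"
    define F where "F = row_seq n m A"
    have N: "N > 0" "n \<le> N" "m \<le> N" using False \<open>m > 0\<close> by (auto simp: N_W_def)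
    have w: "32 * N < 2 ^ w" "w \<le> c * floorlog 2 N"
      using wl by (auto simp: word_length_for_def N_W_def)
    have F_le: "F i \<le> N" for i
      using row_seq_le(1)[of i n m A] row_seq_le(2)[of i n m] by (cases "i < n * m") (auto simp: F_def N_W_def row_seq_def)
    have "W > 0" by (simp add: N_W_def)
    obtain D where len: "length D = 7 + 6 * (N div W) + 4 ^ W * W"
      and words: "\<forall>x\<in>set D. x \<le> length D + N"
      and head: "D ! 0 = n" "D ! 1 = m" "D ! 2 = W"
      and lookup: "\<forall>i\<le>N. let q = i div W; t = i mod W in
      \<exists>R M k B X d. 2 * q + 4 < length D \<and> R = D ! (2 * q + 3) \<and> M = D ! (2 * q + 4) \<and>
        M + t < length D \<and> k = D ! (M + t) \<and> R + 2 * k + 1 < length D \<and>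
        B = D ! (R + 2 * k) \<and> X = D ! (R + 2 * k + 1) \<and> X + t < length D \<and>
        d = D ! (X + t) \<and> F i = B + d"
      using memory_exists[OF mono_row_seq[OF A, folded F_def] F_le \<open>W > 0\<close> N(2,3)] by blast
    have "N div W \<le> N" by (rule div_le_dividend)
    \<comment> \<open>At most \<open>7 + 6 * N + 8 * N\<close> cells and another \<open>N\<close>
      stay below \<open>32 * N\<close>, whence the choice of \<open>32\<close> in the word
      length.\<close>
    then have len_w: "length D + N < 2 ^ w"
      using block_length_bounds(1)[OF N(1) N_W_def(2)] w(1) N(1) len by linarith
    have "computes_within w query 30 D [r, h] (first_ge n A r (int h))" if r: "r < n" for r h
    proof (cases "h < m")
      case False
      have "w > 1" using w(1) N(1) by (cases w; cases "w - 1"; simp)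
      then show ?thesis using query_large[of w D n h r] first_ge_max[OF A r, of h] False head len
        by simp
    next
      case True
      define i where "i = h * n + r"
      have i: "i div n = h" "i mod n = r" using r by (auto simp: i_def)
      have "Suc h * n \<le> m * n" using True by (intro mult_le_mono1) simp
      then have hn: "h * n + n \<le> N" by (simp add: N_W_def mult.commute)
      then have "i < n * m" using r by (simp add: i_def N_W_def)
      then have Fi: "F i = h * n + (n - first_ge n A r (int h))" "i \<le> N"
        by (auto simp: F_def row_seq_def i N_W_def)
      obtain R M k B X d where *: "2 * (i div W) + 4 < length D" "R = D ! (2 * (i div W) + 3)"
        "M = D ! (2 * (i div W) + 4)" "M + i mod W < length D" "k = D ! (M + i mod W)"
        "R + 2 * k + 1 < length D" "B = D ! (R + 2 * k)" "X = D ! (R + 2 * k + 1)"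
        "X + i mod W < length D" "d = D ! (X + i mod W)" "F i = B + d"
        using lookup[rule_format, OF Fi(2)] unfolding Let_def by blast
      have "computes_within w query 30 D [r, h] (h * n + n - (B + d))"
        by (rule query_small[OF head _ True i_def refl refl *(1-10) r])
          (use len_w hn *(11) Fi in auto)
      moreover have "h * n + n - (B + d) = first_ge n A r (int h)"
        using *(11) Fi first_ge_le[of n A r "int h"] by simp
      ultimately show ?thesis by simp
    qed
    moreover have "is_words w D" unfolding is_words_def using words len_w by fastforce
    moreover have "bit_size w D \<le> (119 * c) * (n * m)"
      using block_length_bounds(3)[OF N(1) N_W_def(2) w(2)] len by (simp add: bit_size_def N_W_def)
    ultimately show ?thesis by blast
  qed
qed

end
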